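(* Let $(\mathcal{X},\mathcal{F})$ be a measurable space, let $\mathcal{M}$ be a set of probability measures on $(\mathcal{X},\mathcal{F})$, and let $\mathcal{M}_0,\mathcal{M}_1\subset\mathcal{M}$. If $\mathcal{M}_0\cap\mathcal{M}_1\neq\varnothing$, then for every $n\ge 1$ and every test $\phi_n:\mathcal{X}^n\to\{0,1\}$, $$\alpha_n(\phi_n)+\beta_n(\phi_n)\ge 1 .$$ Consequently, no sequence of tests $(\phi_n)_{n\ge1}$ can satisfy both $\alpha_n(\phi_n)\to 0$ and $\beta_n(\phi_n)\to 0$ as $n\to\infty$.
   Context: For a probability measure $P$ on $(\mathcal{X},\mathcal{F})$, $P^n$ denotes the $n$-fold product measure on $\mathcal{X}^n$ (the law of $n$ independent observations from $P$). A test (nonrandomized) based on $n$ observations is a measurable function $\phi_n:\mathcal{X}^n\to\{0,1\}$. For the hypotheses $H_0:P\in\mathcal{M}_0$ and $H_1:P\in\mathcal{M}_1$, the worst-case Type I and Type II errors are $$\alpha_n(\phi_n)=\sup_{P\in\mathcal{M}_0}P^n(\phi_n=1),\qquad \beta_n(\phi_n)=\sup_{Q\in\mathcal{M}_1}Q^n(\phi_n=0).$$ *)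

theory Defs
  imports "HOL-Probability.Probability"
begin

text \<open>A measurable space is represented by a value \<open>X :: 'a measure\<close> of which only \<open>space X\<close> and
  \<open>sets X\<close> are used. Points of the \<open>n\<close>-fold product are extensional functions on \<open>{..<n}\<close>.\<close>

definition n_fold :: "nat \<Rightarrow> 'a measure \<Rightarrow> (nat \<Rightarrow> 'a) measure" where
  "n_fold n P = PiM {..<n} (\<lambda>_. P)"

definition is_test :: "'a measure \<Rightarrow> nat \<Rightarrow> ((nat \<Rightarrow> 'a) \<Rightarrow> nat) \<Rightarrow> bool" where
  "is_test X n \<phi> \<longleftrightarrow> \<phi> \<in> n_fold n X \<rightarrow>\<^sub>M count_space {0, 1}"

text \<open>The suprema are taken in \<open>ennreal\<close>, a complete lattice, so they are genuine suprema without
  side conditions, and the supremum over an empty hypothesis is \<open>0\<close>.\<close>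

definition type1_error :: "nat \<Rightarrow> 'a measure set \<Rightarrow> ((nat \<Rightarrow> 'a) \<Rightarrow> nat) \<Rightarrow> ennreal" where
  "type1_error n M0 \<phi> = (SUP P\<in>M0. emeasure (n_fold n P) {x \<in> space (n_fold n P). \<phi> x = 1})"

definition type2_error :: "nat \<Rightarrow> 'a measure set \<Rightarrow> ((nat \<Rightarrow> 'a) \<Rightarrow> nat) \<Rightarrow> ennreal" where
  "type2_error n M1 \<phi> = (SUP Q\<in>M1. emeasure (n_fold n Q) {x \<in> space (n_fold n Q). \<phi> x = 0})"

end

theory Submission
  imports Defs
begin

text \<open>A distribution \<open>P\<close> lying in both hypotheses makes the two errors compete: under \<open>P\<^sup>n\<close> every
  sample is either rejected or accepted, so the rejection and acceptance probabilities sum to \<open>1\<close>,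
  while the worst-case Type I error dominates the former and the worst-case Type II error the
  latter. A constant lower bound on the sum of the errors passes to the limit, so they cannot both
  tend to \<open>0\<close>.\<close>

lemma prob_space_n_fold: "prob_space P \<Longrightarrow> prob_space (n_fold n P)"
  unfolding n_fold_def by (rule prob_space_PiM)

lemma sets_n_fold_cong: "sets P = sets X \<Longrightarrow> sets (n_fold n P) = sets (n_fold n X)"
  unfolding n_fold_def by (rule sets_PiM_cong) auto

text \<open>Measurability of a test depends on the \<open>\<sigma>\<close>-algebra of the sample space alone, so a test on
  \<open>X\<close> splits the sample space of each \<open>P\<close> on that \<open>\<sigma>\<close>-algebra into two events.\<close>

lemma emeasure_reject_plus_accept:
  assumes "prob_space P" "sets P = sets X" "is_test X n \<phi>"
  shows "emeasure (n_fold n P) {x \<in> space (n_fold n P). \<phi> x = 1} +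
         emeasure (n_fold n P) {x \<in> space (n_fold n P). \<phi> x = 0} = 1"
proof -
  interpret prob_space "n_fold n P"
    using assms(1) by (rule prob_space_n_fold)
  let ?R = "{x \<in> space (n_fold n P). \<phi> x = 1}" and ?A = "{x \<in> space (n_fold n P). \<phi> x = 0}"
  have \<phi>: "\<phi> \<in> n_fold n P \<rightarrow>\<^sub>M count_space {0, 1}"
    using assms(3) measurable_cong_sets[OF sets_n_fold_cong[OF assms(2)] refl]
    unfolding is_test_def by blast
  have vimages: "?R = \<phi> -` {1} \<inter> space (n_fold n P)" "?A = \<phi> -` {0} \<inter> space (n_fold n P)"
    by auto
  have "?R \<in> sets (n_fold n P)" "?A \<in> sets (n_fold n P)"
    unfolding vimages by (rule measurable_sets[OF \<phi>], simp)+
  then have "emeasure (n_fold n P) ?R + emeasure (n_fold n P) ?A = emeasure (n_fold n P) (?R \<union> ?A)"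
    by (intro plus_emeasure) auto
  also have "?R \<union> ?A = space (n_fold n P)"
    using measurable_space[OF \<phi>] by fastforce
  finally show ?thesis
    by (simp add: emeasure_space_1)
qed

lemma one_le_sum_of_errors:
  assumes "P \<in> M0" "P \<in> M1" "prob_space P" "sets P = sets X" "is_test X n \<phi>"
  shows "1 \<le> type1_error n M0 \<phi> + type2_error n M1 \<phi>"
  unfolding emeasure_reject_plus_accept[OF assms(3-5), symmetric] type1_error_def type2_error_def
  using assms(1,2) by (intro add_mono SUP_upper)

theorem lemma1:
  fixes X :: "'a measure" and M M0 M1 :: "'a measure set"
  assumes "\<And>P. P \<in> M \<Longrightarrow> prob_space P \<and> sets P = sets X"
    and "M0 \<subseteq> M" and "M1 \<subseteq> M"
    and "M0 \<inter> M1 \<noteq> {}"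
  shows "(\<forall>n\<ge>1. \<forall>\<phi>. is_test X n \<phi> \<longrightarrow> type1_error n M0 \<phi> + type2_error n M1 \<phi> \<ge> 1) \<and>
    \<not> (\<exists>\<phi>. (\<forall>n\<ge>1. is_test X n (\<phi> n)) \<and>
        (\<lambda>n. type1_error n M0 (\<phi> n)) \<longlonglongrightarrow> 0 \<and>
        (\<lambda>n. type2_error n M1 (\<phi> n)) \<longlonglongrightarrow> 0)"
proof -
  obtain P where "P \<in> M0" "P \<in> M1"
    using assms(4) by blast
  moreover from this have "prob_space P" "sets P = sets X"
    using assms(1,2) by blast+
  ultimately have bound: "1 \<le> type1_error n M0 \<phi> + type2_error n M1 \<phi>" if "is_test X n \<phi>" for n \<phi>
    using that by (rule one_le_sum_of_errors)
  have False
    if tests: "\<forall>n\<ge>1. is_test X n (\<phi> n)"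
      and lim1: "(\<lambda>n. type1_error n M0 (\<phi> n)) \<longlonglongrightarrow> 0"
      and lim2: "(\<lambda>n. type2_error n M1 (\<phi> n)) \<longlonglongrightarrow> 0" for \<phi>
  proof -
    have "(\<lambda>n. type1_error n M0 (\<phi> n) + type2_error n M1 (\<phi> n)) \<longlonglongrightarrow> 0 + 0"
      using lim1 lim2 by (rule tendsto_add)
    then have "(1 :: ennreal) \<le> 0 + 0"
      using tests bound by (intro LIMSEQ_le_const) blast+
    then show False
      by simp
  qed
  with bound show ?thesis
    by blast
qed

end
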